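(* Let $\mathcal{J}:\mathbb{R}^n\to\mathbb{R}\cup\{\infty\}$ be coercive, proper, lower semi-continuous, and continuous on its domain $\operatorname{dom}\mathcal{J}$. Let $V_1,\dots,V_m\subset\mathbb{R}^n$ be linear subspaces with $\mathbb{R}^n=\sum_{k=1}^m V_k$ (not necessarily direct), and assume that for each $w\in\operatorname{dom}\mathcal{J}$ and each $k$ the function $V_k\ni v\mapsto\mathcal{J}(w+v)$ has a unique global minimizer. Assume that the decomposition $\mathbb{R}^n=\sum_{k=1}^mV_k$ is compatible with $\mathcal{J}$, and that $\mathcal{J}$ has a unique global minimizer $u^*\in\mathbb{R}^n$. Let $\mathcal{M}_k:\operatorname{dom}\mathcal{J}\to\operatorname{dom}\mathcal{J}$ satisfy $\mathcal{M}_k(w)-w\in V_k$ for all $w\in\operatorname{dom}\mathcal{J}$ ($k=1,\dots,m$), let $\mathcal{C}:\operatorname{dom}\mathcal{J}\to\operatorname{dom}\mathcal{J}$, let $u^0\in\operatorname{dom}\mathcal{J}$, and define $u^{\nu+1}=\mathcal{C}\bigl((\mathcal{M}_m\circ\dots\circ\mathcal{M}_1)(u^\nu)\bigr)$ for $\nu\ge0$. Assume that there are maps $\tilde{\mathcal{M}}_k:\operatorname{dom}\mathcal{J}\to\operatorname{dom}\mathcal{J}$ with $\tilde{\mathcal{M}}_k(w)-w\in V_k$ for all $w\in\operatorname{dom}\mathcal{J}$, such that for every $k$: 1. $\mathcal{J}(\mathcal{M}_k(v))\le\mathcal{J}(\tilde{\mathcal{M}}_k(v))\le\mathcal{J}(v)$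 and $\mathcal{J}(\mathcal{C}(v))\le\mathcal{J}(v)$ for all $v\in\operatorname{dom}\mathcal{J}$; 2. $\mathcal{J}\circ\tilde{\mathcal{M}}_k$ is continuous on $\operatorname{dom}\mathcal{J}$; 3. $\mathcal{J}(\tilde{\mathcal{M}}_k(v))<\mathcal{J}(v)$ for every $v\in\operatorname{dom}\mathcal{J}$ such that $\mathcal{J}(v)$ is not minimal in $v+V_k$. Then $u^\nu$ converges to $u^*$ as $\nu\to\infty$.
   Context: $\operatorname{dom}\mathcal{J}=\{x\in\mathbb{R}^n : \mathcal{J}(x)<\infty\}$, with the topology induced from $\mathbb{R}^n$. Coercive means $\mathcal{J}(v)\to\infty$ as $\|v\|\to\infty$. "Continuous on its domain" means that the restriction of $\mathcal{J}$ to $\operatorname{dom}\mathcal{J}$ is continuous. The decomposition $\mathbb{R}^n=\sum_{k=1}^mV_k$ is called compatible with $\mathcal{J}$ if for every $u\in\operatorname{dom}\mathcal{J}$ the property "$\mathcal{J}(u)\le\mathcal{J}(u+v)$ for all $v\in V_k$, $k=1,\dots,m$" implies "$\mathcal{J}(u)\le\mathcal{J}(u+v)$ for all $v\in\mathbb{R}^n$". *)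

theory Defs
  imports "HOL-Analysis.Analysis"
begin

definition effective_domain :: "('a \<Rightarrow> ereal) \<Rightarrow> 'a set" where
  "effective_domain J = {x. J x < \<infinity>}"

text \<open>The codomain \<open>\<real> \<union> {\<infinity>}\<close> is represented by \<^typ>\<open>ereal\<close> with the value \<open>-\<infinity>\<close> excluded;
  this exclusion is part of properness, as usual in convex analysis.\<close>

definition proper_fun :: "('a \<Rightarrow> ereal) \<Rightarrow> bool" where
  "proper_fun J \<longleftrightarrow> (\<forall>x. J x \<noteq> -\<infinity>) \<and> effective_domain J \<noteq> {}"

definition coercive :: "('a::real_normed_vector \<Rightarrow> ereal) \<Rightarrow> bool" where
  "coercive J \<longleftrightarrow> (J \<longlongrightarrow> \<infinity>) at_infinity"

definition lower_semicontinuous :: "('a::topological_space \<Rightarrow> ereal) \<Rightarrow> bool" where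
  "lower_semicontinuous J \<longleftrightarrow> (\<forall>x. J x \<le> Liminf (at x) J)"

text \<open>The sum of the subspaces is the Minkowski sum of sets; it need not be direct.\<close>

definition subspace_decomposition :: "nat \<Rightarrow> (nat \<Rightarrow> 'a::real_vector set) \<Rightarrow> bool" where
  "subspace_decomposition m V \<longleftrightarrow>
     (\<forall>k\<in>{1..m}. subspace (V k)) \<and> (\<Sum>k=1..m. V k) = UNIV"

definition compatible :: "('a::real_vector \<Rightarrow> ereal) \<Rightarrow> nat \<Rightarrow> (nat \<Rightarrow> 'a set) \<Rightarrow> bool" where
  "compatible J m V \<longleftrightarrow>
     (\<forall>u\<in>effective_domain J.
        (\<forall>k\<in>{1..m}. \<forall>v\<in>V k. J u \<le> J (u + v)) \<longrightarrow> (\<forall>v. J u \<le> J (u + v)))"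

end

theory Submission
  imports Defs
begin

text \<open>The energies \<open>J (u \<nu>)\<close> decrease to some \<open>l\<close>, and all intermediate iterates stay in the
  compact sublevel set of \<open>J (u 0)\<close>. Let \<open>x\<close> be the limit of a convergent subsequence. If the
  iterates after \<open>j\<close> substeps converge to \<open>x\<close> along it, then continuity of
  \<open>J\<close> and \<open>J \<circ> Mt (j+1)\<close> yields \<open>J (Mt (j+1) x) = l = J x\<close>, so \<open>x\<close> minimizes \<open>J\<close> on
  \<open>x + V (j+1)\<close>. Limit points of the iterates after \<open>j + 1\<close> substeps lie in
  \<open>x + V (j+1)\<close> and have the same energy, so they coincide with \<open>x\<close> by uniqueness; no continuity of
  \<open>M\<close> is needed. By compatibility \<open>x\<close> is then the global minimizer.\<close>

text \<open>If \<open>X\<close> missed a neighbourhood \<open>U\<close> of \<open>x\<close>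
  infinitely often, compactness would give the missed terms a convergent subsequence, whose limit
  stays in the closed set \<open>- U\<close> and so differs from \<open>x\<close>. Used both for a
  single substep and for the whole sequence.\<close>

lemma compact_tendsto_if_unique_limit:
  fixes X :: "nat \<Rightarrow> 'a::metric_space"
  assumes K: "compact K" and X: "\<And>n. X n \<in> K"
    and uniq: "\<And>r y. strict_mono r \<Longrightarrow> (\<lambda>n. X (r n)) \<longlonglongrightarrow> y \<Longrightarrow> y = x"
  shows "X \<longlonglongrightarrow> x"
proof (rule topological_tendstoI, rule ccontr)
  fix U assume U: "open U" "x \<in> U" and "\<not> (\<forall>\<^sub>F n in sequentially. X n \<in> U)"
  then obtain r :: "nat \<Rightarrow> nat" where r: "strict_mono r" "\<And>n. X (r n) \<notin> U"
    using not_eventually_sequentiallyD by blast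
  obtain y s where s: "strict_mono s" and lim: "((\<lambda>n. X (r n)) \<circ> s) \<longlonglongrightarrow> y"
    using K X unfolding compact_def by meson
  have "y = x"
    using uniq[of "r \<circ> s" y] strict_mono_o[OF r(1) s] lim by (simp add: o_def)
  moreover have "y \<in> - U"
    by (rule closed_sequentially[OF _ _ lim]) (use U(1) r(2) in auto)
  ultimately show False using U(2) by simp
qed

lemma lower_semicontinuous_closed_sublevel:
  assumes "lower_semicontinuous J"
  shows "closed {x. J x \<le> c}"
proof -
  have "open {x. c < J x}"
  proof (subst open_subopen, intro ballI)
    fix x assume "x \<in> {x. c < J x}"
    then have cx: "c < J x" by simp
    then have "c < Liminf (at x) J"
      using assms unfolding lower_semicontinuous_def by (meson less_le_trans)
    then have "\<forall>\<^sub>F y in at x. c < J y" by (rule less_LiminfD)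
    then obtain S where S: "open S" "x \<in> S" "\<forall>y\<in>S. y \<noteq> x \<longrightarrow> c < J y"
      unfolding eventually_at_topological by blast
    \<comment> \<open>The filter \<open>at x\<close> leaves out \<open>x\<close> itself;
      \<open>cx\<close> supplies that point.\<close>
    from S(3) cx have "S \<subseteq> {x. c < J x}" by auto
    with S(1,2) show "\<exists>T. open T \<and> x \<in> T \<and> T \<subseteq> {x. c < J x}" by blast
  qed
  moreover have "{x. J x \<le> c} = - {x. c < J x}" by auto
  ultimately show ?thesis by (simp add: closed_def)
qed

lemma coercive_compact_sublevel:
  fixes J :: "'a::euclidean_space \<Rightarrow> ereal"
  assumes "coercive J" "lower_semicontinuous J" "c < \<infinity>"
  shows "compact {x. J x \<le> c}"
proof -
  have "\<forall>\<^sub>F x in at_infinity. c < J x"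
    using assms(1,3) order_tendstoD(1) unfolding coercive_def by blast
  then obtain b where "\<And>x. norm x \<ge> b \<Longrightarrow> c < J x"
    unfolding eventually_at_infinity by blast
  then have "norm x \<le> b" if "J x \<le> c" for x
    using that by (meson linorder_not_less nle_le)
  then have "bounded {x. J x \<le> c}" unfolding bounded_iff by blast
  then show ?thesis
    using lower_semicontinuous_closed_sublevel[OF assms(2)] compact_eq_bounded_closed by blast
qed

text \<open>One substep along a subsequence: \<open>X\<close> and \<open>Y\<close> are the iterates
  before and after it, \<open>N\<close> is the comparison map \<open>Mt k\<close>. The actual map
  \<open>M k\<close> enters only through the bounds on \<open>Y\<close>, so it may be
  discontinuous.\<close>

lemma substep_tendsto:
  fixes J :: "'a::euclidean_space \<Rightarrow> ereal"
  assumes K: "compact K" "K \<subseteq> effective_domain J"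
    and cont: "continuous_on (effective_domain J) J"
    and V: "subspace V"
    and uniq: "\<exists>!v. is_arg_min (\<lambda>v. J (x + v)) (\<lambda>v. v \<in> V) v"
    and contN: "continuous_on (effective_domain J) (J \<circ> N)"
    and descent: "\<not> is_arg_min J (\<lambda>w. w \<in> x +o V) x \<Longrightarrow> J (N x) < J x"
    and X: "\<And>n. X n \<in> K" "X \<longlonglongrightarrow> x" "(\<lambda>n. J (X n)) \<longlonglongrightarrow> l"
    and Y: "\<And>n. Y n \<in> K" "\<And>n. Y n - X n \<in> V" "(\<lambda>n. J (Y n)) \<longlonglongrightarrow> l"
      "\<And>n. J (Y n) \<le> J (N (X n))"
  shows "is_arg_min J (\<lambda>w. w \<in> x +o V) x" and "Y \<longlonglongrightarrow> x"
proof -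
  have closedK: "closed K" using K(1) by (rule compact_imp_closed)
  \<comment> \<open>Lower semicontinuity alone would give only \<open>J z \<le> l\<close>. Equality
    holds because the closed set \<open>K\<close> keeps \<open>z\<close> inside the domain, where
    \<open>J\<close> is continuous.\<close>
  have energy: "J z = l"
    if "\<And>n. Z n \<in> K" "Z \<longlonglongrightarrow> z" "(\<lambda>n. J (Z n)) \<longlonglongrightarrow> l" for Z z
  proof -
    have "z \<in> K" by (rule closed_sequentially[OF closedK that(1,2)])
    then have "(\<lambda>n. J (Z n)) \<longlonglongrightarrow> J z"
      using continuous_on_tendsto_compose[OF cont that(2)] that(1) K(2)
      by (simp add: subset_iff)
    then show ?thesis using that(3) by (rule LIMSEQ_unique)
  qed
  have xK: "x \<in> K" by (rule closed_sequentially[OF closedK X(1,2)])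
  have Jx: "J x = l" by (rule energy[OF X])
  have "(\<lambda>n. J (N (X n))) \<longlonglongrightarrow> J (N x)"
    using continuous_on_tendsto_compose[OF contN X(2)] xK X(1) K(2)
    by (simp add: subset_iff)
  then have "l \<le> J (N x)"
    by (rule LIMSEQ_le[OF Y(3)]) (use Y(4) in blast)
  \<comment> \<open>Otherwise strict descent would give \<open>J (N x) < J x = l\<close>.\<close>
  with descent Jx show min: "is_arg_min J (\<lambda>w. w \<in> x +o V) x" by force
  have least: "J x \<le> J (x + v)" if "v \<in> V" for v
    using min that unfolding is_arg_min_def elt_set_plus_def by (auto simp: not_less)
  show "Y \<longlonglongrightarrow> x"
  proof (rule compact_tendsto_if_unique_limit[OF K(1) Y(1)])
    fix r y assume r: "strict_mono (r :: nat \<Rightarrow> nat)" and lim: "(\<lambda>n. Y (r n)) \<longlonglongrightarrow> y"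
    have "(\<lambda>n. J (Y (r n))) \<longlonglongrightarrow> l" "(\<lambda>n. X (r n)) \<longlonglongrightarrow> x"
      using LIMSEQ_subseq_LIMSEQ[OF Y(3) r] LIMSEQ_subseq_LIMSEQ[OF X(2) r]
      by (simp_all add: o_def)
    then have Jy: "J y = J x" and diff: "(\<lambda>n. Y (r n) - X (r n)) \<longlonglongrightarrow> y - x"
      using energy[of "\<lambda>n. Y (r n)", OF Y(1) lim] Jx tendsto_diff[OF lim] by simp_all
    have "y - x \<in> V"
      by (rule closed_sequentially[OF closed_subspace[OF V] _ diff]) (rule Y(2))
    \<comment> \<open>Equal energy makes \<open>y - x\<close> as good a minimizer on
      \<open>V\<close> as \<open>0\<close>.\<close>
    then have "is_arg_min (\<lambda>v. J (x + v)) (\<lambda>v. v \<in> V) (y - x)"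
      and "is_arg_min (\<lambda>v. J (x + v)) (\<lambda>v. v \<in> V) 0"
      using least Jy subspace_0[OF V] by (auto simp: is_arg_min_def not_less)
    with uniq have "y - x = 0" by blast
    then show "y = x" by simp
  qed
qed

theorem corollary4p4:
  fixes J :: "real ^ 'n \<Rightarrow> ereal"
    and m :: nat
    and V :: "nat \<Rightarrow> (real ^ 'n) set"
    and M Mt :: "nat \<Rightarrow> real ^ 'n \<Rightarrow> real ^ 'n"
    and C :: "real ^ 'n \<Rightarrow> real ^ 'n"
    and u :: "nat \<Rightarrow> real ^ 'n"
    and u_star :: "real ^ 'n"
  assumes "coercive J"
    and "proper_fun J"
    and "lower_semicontinuous J"
    and "continuous_on (effective_domain J) J"
    and "subspace_decomposition m V"
    and "\<And>w k. \<lbrakk>w \<in> effective_domain J; k \<in> {1..m}\<rbrakk>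
           \<Longrightarrow> \<exists>!v. is_arg_min (\<lambda>v. J (w + v)) (\<lambda>v. v \<in> V k) v"
    and "compatible J m V"
    and "\<And>x. is_arg_min J (\<lambda>x. x \<in> UNIV) x \<longleftrightarrow> x = u_star"
    and "\<And>k. k \<in> {1..m} \<Longrightarrow> M k \<in> effective_domain J \<rightarrow> effective_domain J"
    and "\<And>k w. \<lbrakk>k \<in> {1..m}; w \<in> effective_domain J\<rbrakk> \<Longrightarrow> M k w - w \<in> V k"
    and "C \<in> effective_domain J \<rightarrow> effective_domain J"
    and "u 0 \<in> effective_domain J"
    and "\<And>\<nu>. u (Suc \<nu>) = C (fold M [1..<Suc m] (u \<nu>))"
    and "\<And>k. k \<in> {1..m} \<Longrightarrow> Mt k \<in> effective_domain J \<rightarrow> effective_domain J"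
    and "\<And>k w. \<lbrakk>k \<in> {1..m}; w \<in> effective_domain J\<rbrakk> \<Longrightarrow> Mt k w - w \<in> V k"
    and "\<And>k v. \<lbrakk>k \<in> {1..m}; v \<in> effective_domain J\<rbrakk>
           \<Longrightarrow> J (M k v) \<le> J (Mt k v) \<and> J (Mt k v) \<le> J v"
    and "\<And>v. v \<in> effective_domain J \<Longrightarrow> J (C v) \<le> J v"
    and "\<And>k. k \<in> {1..m} \<Longrightarrow> continuous_on (effective_domain J) (J \<circ> Mt k)"
    and "\<And>k v. \<lbrakk>k \<in> {1..m}; v \<in> effective_domain J; \<not> is_arg_min J (\<lambda>w. w \<in> v +o V k) v\<rbrakk>
           \<Longrightarrow> J (Mt k v) < J v"
  shows "u \<longlonglongrightarrow> u_star"
proof -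
  note dom = assms(12) and step = assms(13)
  \<comment> \<open>The iterate after \<open>j\<close> substeps of sweep \<nu>; the list is empty
    for \<open>j = 0\<close>, and \<open>fold\<close> applies \<open>M 1\<close> first.\<close>
  define w where "w j \<nu> = fold M [1..<Suc j] (u \<nu>)" for j \<nu>
  have w0: "w 0 \<nu> = u \<nu>" for \<nu> by (simp add: w_def)
  have wS: "w (Suc j) \<nu> = M (Suc j) (w j \<nu>)" for j \<nu> by (simp add: w_def)
  have uS: "u (Suc \<nu>) = C (w m \<nu>)" for \<nu> unfolding w_def by (rule step)
  \<comment> \<open>Stated conditionally because membership of \<open>u (Suc \<nu>)\<close> in the
    domain rests on that of \<open>w m \<nu>\<close>, which in turn rests on that of
    \<open>u \<nu>\<close>.\<close>
  have wdom_if: "w j \<nu> \<in> effective_domain J"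
    if "j \<le> m" "u \<nu> \<in> effective_domain J" for j \<nu>
    using that
  proof (induction j)
    case (Suc j)
    then show ?case using assms(9)[of "Suc j"] by (auto simp: wS)
  qed (simp add: w0)
  have udom: "u \<nu> \<in> effective_domain J" for \<nu>
  proof (induction \<nu>)
    case (Suc \<nu>)
    then show ?case using assms(11) wdom_if[of m \<nu>] by (auto simp: uS)
  qed (rule dom)
  have wdom: "w j \<nu> \<in> effective_domain J" if "j \<le> m" for j \<nu>
    by (rule wdom_if[OF that udom])
  have sub: "J (w (Suc j) \<nu>) \<le> J (Mt (Suc j) (w j \<nu>))"
    "J (Mt (Suc j) (w j \<nu>)) \<le> J (w j \<nu>)" if "j < m" for j \<nu>
    using assms(16)[of "Suc j" "w j \<nu>"] wdom[of j \<nu>] that by (auto simp: wS)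
  have upper: "J (w j \<nu>) \<le> J (u \<nu>)" if "j \<le> m" for j \<nu>
    using that
  proof (induction j)
    case (Suc j)
    then show ?case using sub[of j \<nu>] by auto
  qed (simp add: w0)
  \<comment> \<open>Induction downwards from \<open>j = m\<close>, since energies fall as
    \<open>j\<close> grows.\<close>
  have "J (w m \<nu>) \<le> J (w j \<nu>)" if "j \<le> m" for j \<nu>
    using that
  proof (induction rule: inc_induct)
    case (step j)
    then show ?case using sub[of j \<nu>] by auto
  qed simp
  moreover have "J (u (Suc \<nu>)) \<le> J (w m \<nu>)" for \<nu>
    unfolding uS by (rule assms(17)[OF wdom[OF order_refl]])
  ultimately have lower: "J (u (Suc \<nu>)) \<le> J (w j \<nu>)" if "j \<le> m" for j \<nu>
    using that by (meson order_trans)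
  have dec: "decseq (\<lambda>\<nu>. J (u \<nu>))"
    using lower[of 0] by (auto simp: w0 intro: decseq_SucI)
  \<comment> \<open>In \<open>ereal\<close> a decreasing sequence tends to its infimum, so
    \<open>l\<close> exists before any lower bound is known.\<close>
  then obtain l where l: "(\<lambda>\<nu>. J (u \<nu>)) \<longlonglongrightarrow> l"
    using LIMSEQ_INF[OF dec] by blast
  \<comment> \<open>Each intermediate energy lies between \<open>J (u (Suc \<nu>))\<close> and
    \<open>J (u \<nu>)\<close>, so all share the limit \<open>l\<close>.\<close>
  have wl: "(\<lambda>\<nu>. J (w j \<nu>)) \<longlonglongrightarrow> l" if "j \<le> m" for j
    by (rule tendsto_sandwich[OF _ _ LIMSEQ_Suc[OF l] l]) (use lower upper that in auto)
  define K where "K = {x. J x \<le> J (u 0)}"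
  have fin: "J (u 0) < \<infinity>" using dom by (simp add: effective_domain_def)
  have K: "compact K"
    unfolding K_def using coercive_compact_sublevel[OF assms(1,3) fin] .
  have Kdom: "K \<subseteq> effective_domain J"
    using fin by (auto simp: K_def effective_domain_def)
  have wK: "w j \<nu> \<in> K" if "j \<le> m" for j \<nu>
    using upper[OF that, of \<nu>] decseqD[OF dec, of 0 \<nu>] by (auto simp: K_def)
  show "u \<longlonglongrightarrow> u_star"
  proof (rule compact_tendsto_if_unique_limit[OF K])
    show "u n \<in> K" for n using wK[of 0 n] by (simp add: w0)
    fix r x assume r: "strict_mono (r :: nat \<Rightarrow> nat)" and lim: "(\<lambda>n. u (r n)) \<longlonglongrightarrow> x"
    have "x \<in> K"
      using closed_sequentially[OF compact_imp_closed[OF K] _ lim] wK[of 0] by (simp add: w0)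
    then have xdom: "x \<in> effective_domain J" using Kdom by blast
    have wl': "(\<lambda>n. J (w j (r n))) \<longlonglongrightarrow> l" if "j \<le> m" for j
      using LIMSEQ_subseq_LIMSEQ[OF wl[OF that] r] by (simp add: o_def)
    have V: "subspace (V k)" if "k \<in> {1..m}" for k
      using assms(5) that by (simp add: subspace_decomposition_def)
    have substep: "is_arg_min J (\<lambda>z. z \<in> x +o V (Suc j)) x"
      "(\<lambda>n. w (Suc j) (r n)) \<longlonglongrightarrow> x"
      if j: "j < m" and "(\<lambda>n. w j (r n)) \<longlonglongrightarrow> x" for j
    proof -
      have k: "Suc j \<in> {1..m}" using j by auto
      have diff: "w (Suc j) (r n) - w j (r n) \<in> V (Suc j)" for n
        using assms(10)[OF k] wdom[of j "r n"] j by (simp add: wS)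
      note * = substep_tendsto[OF K Kdom assms(4) V[OF k] assms(6)[OF xdom k] assms(18)[OF k]
        assms(19)[OF k xdom] wK that(2) wl' wK diff wl' sub(1)[OF j]]
      show "is_arg_min J (\<lambda>z. z \<in> x +o V (Suc j)) x" "(\<lambda>n. w (Suc j) (r n)) \<longlonglongrightarrow> x"
        by (rule *; use j in simp)+
    qed
    \<comment> \<open>The same \<open>r\<close> serves for every \<open>j\<close>: each substep
      passes on full convergence along \<open>r\<close>, and no further subsequence is extracted.
      Hence one point \<open>x\<close> is minimal in all directions \<open>V k\<close> at
      once.\<close>
    have wlim: "(\<lambda>n. w j (r n)) \<longlonglongrightarrow> x" if "j \<le> m" for j
      using that
    proof (induction j)
      case (Suc j)
      then show ?case using substep(2)[of j] by simp
    qed (simp add: w0 lim)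
    have "J x \<le> J (x + v)" if k: "k \<in> {1..m}" and v: "v \<in> V k" for k v
    proof -
      obtain j where j: "k = Suc j" "j < m" using k by (cases k) auto
      then have "is_arg_min J (\<lambda>z. z \<in> x +o V k) x"
        using substep(1) wlim[of j] by simp
      then show ?thesis using v by (auto simp: is_arg_min_def elt_set_plus_def not_less)
    qed
    then have "J x \<le> J (x + v)" for v
      using assms(7) xdom unfolding compatible_def by blast
    then have "J x \<le> J y" for y by (metis add_diff_cancel_left' diff_add_cancel add.commute)
    then have "is_arg_min J (\<lambda>x. x \<in> UNIV) x"
      by (auto simp: is_arg_min_def not_less)
    then show "x = u_star" using assms(8) by blast
  qed
qed

end
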